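(* Let $m=n+k$ and let $L,R\in\mathbb{C}^{m\times m}$ be two unitary matrices, where $L$ is a proper $k$-lower Hessenberg matrix and $R$ is a proper $k$-upper Hessenberg matrix. Let $U=\begin{bmatrix} I_k & 0\\ 0& \hat U\end{bmatrix}\in\mathbb{C}^{m\times m}$ with $\hat U\in\mathbb{C}^{n\times n}$ unitary, let $E=[I_k,0]^T\in\mathbb{C}^{m\times k}$, let $Z\in\mathbb{C}^{m\times k}$, and set $F=U+EZ^*$. Suppose that the matrix $\hat A=LFR$ has its last $k$ rows equal to zero, i.e. it has the block structure $$\hat A=\begin{bmatrix} A & B\\ 0_{k\times n} & 0_{k\times k}\end{bmatrix},\qquad A\in\mathbb{C}^{n\times n},\ B\in\mathbb{C}^{n\times k}.$$ Then $A=\hat A(1:n,1:n)$ is nonsingular and has the same staircase profile as $\hat U$, that is, $m_j(A)=m_j(\hat U)$ for all $1\le j\le n$.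
   Context: Here $n,k\ge 1$ are integers, and $M^*$ denotes the conjugate transpose of $M$. A matrix $R\in\mathbb{C}^{m\times m}$ is $k$-upper Hessenberg if $r_{ij}=0$ whenever $i>j+k$; it is proper if moreover $r_{j+k,j}\ne 0$ for $1\le j\le m-k$. A matrix $L\in\mathbb{C}^{m\times m}$ is $k$-lower Hessenberg if $l_{ij}=0$ whenever $j>i+k$; it is proper if moreover $l_{j,j+k}\neq 0$ for $1\le j\le m-k$. The (lower) staircase (profile) of a matrix $A=(a_{i,j})\in\mathbb{C}^{n\times n}$ is the sequence $m_j(A)$, $1\le j\le n$, defined by $m_0(A)=0$ and $m_j(A)=\max\{m_{j-1}(A),\ \max_{i>j}\{i: a_{i,j}\ne 0\}\}$, where the maximum of the empty set is taken to be $0$. *)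

theory Defs
  imports "Jordan_Normal_Form.Schur_Decomposition"
begin

definition unitary_mat :: "complex mat \<Rightarrow> bool" where
  "unitary_mat M \<longleftrightarrow> square_mat M \<and>
     M * mat_adjoint M = 1\<^sub>m (dim_row M) \<and> mat_adjoint M * M = 1\<^sub>m (dim_row M)"

(* Matrix indices start at 0; the conditions below only compare indices with each other,
   so they read the same with indices starting at 1. *)
definition upper_hessenberg :: "nat \<Rightarrow> complex mat \<Rightarrow> bool" where
  "upper_hessenberg k R \<longleftrightarrow>
     (\<forall>i < dim_row R. \<forall>j < dim_col R. i > j + k \<longrightarrow> R $$ (i, j) = 0)"

definition proper_upper_hessenberg :: "nat \<Rightarrow> complex mat \<Rightarrow> bool" where
  "proper_upper_hessenberg k R \<longleftrightarrow> upper_hessenberg k R \<and>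
     (\<forall>j < dim_row R - k. R $$ (j + k, j) \<noteq> 0)"

definition lower_hessenberg :: "nat \<Rightarrow> complex mat \<Rightarrow> bool" where
  "lower_hessenberg k L \<longleftrightarrow>
     (\<forall>i < dim_row L. \<forall>j < dim_col L. j > i + k \<longrightarrow> L $$ (i, j) = 0)"

definition proper_lower_hessenberg :: "nat \<Rightarrow> complex mat \<Rightarrow> bool" where
  "proper_lower_hessenberg k L \<longleftrightarrow> lower_hessenberg k L \<and>
     (\<forall>j < dim_row L - k. L $$ (j, j + k) \<noteq> 0)"

(* Here i and j count rows and columns from 1, since the value 0 stands for the empty maximum;
   the 1-based entry (i, j) is A $$ (i - 1, j - 1). Inserting 0 realizes max {} = 0. *)
fun staircase :: "complex mat \<Rightarrow> nat \<Rightarrow> nat" where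
  "staircase A 0 = 0"
| "staircase A (Suc j) = max (staircase A j)
     (Max (insert 0 {i. Suc j < i \<and> i \<le> dim_row A \<and> A $$ (i - 1, j) \<noteq> 0}))"

end

theory Submission
  imports Defs
begin

text \<open>
  Since L is unitary, the hypothesis reads F R = L* Ah. In the last n rows and first n columns
  the rank-k correction E Z* and the zero block of Ah drop out, which leaves Uh S = T A with
  S and T the n x n lower left corners of R and L*. The proper Hessenberg conditions say
  precisely that S and T are upper triangular with nonzero diagonal, so determinants show that A is
  nonsingular. The staircase is a statement about zero regions that are closed under moving
  down and to the left within the strictly lower triangle; such regions are unaffected by
  multiplication with S on the right or T on the left.
\<close>

lemma mat_mult_entry:
  assumes "A \<in> carrier_mat p q" "B \<in> carrier_mat q r" "i < p" "j < r"
  shows "(A * B) $$ (i, j) = (\<Sum>l<q. A $$ (i, l) * B $$ (l, j))"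
  using assms by (auto simp: scalar_prod_def lessThan_atLeast0 intro!: sum.cong)

lemma sum_lessThan_add:
  fixes f :: "nat \<Rightarrow> 'a :: comm_monoid_add"
  shows "(\<Sum>l<n + k. f l) = (\<Sum>l<n. f l) + (\<Sum>l<k. f (n + l))"
  by (induction k) (simp_all add: add.assoc)

lemma mat_adjoint_carrier [intro]:
  "A \<in> carrier_mat p q \<Longrightarrow> mat_adjoint A \<in> carrier_mat q p"
  by (auto simp: mat_adjoint_def)

lemma mat_adjoint_entry:
  assumes "A \<in> carrier_mat p q" "i < q" "j < p"
  shows "mat_adjoint A $$ (i, j) = conjugate (A $$ (j, i))"
  using assms by (auto simp: mat_adjoint_def mat_of_rows_def)

text \<open>Replaces the recursive maximum by a zero pattern over all columns before
  \<open>j\<close>. Since \<open>staircase\<close> counts rows from 1, a 0-based row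
  \<open>r\<close> lies beyond the bound \<open>p\<close> exactly when
  \<open>p \<le> r\<close>.\<close>

definition lower_zero :: "nat \<Rightarrow> nat \<Rightarrow> 'a :: zero mat \<Rightarrow> bool" where
  "lower_zero p j M \<longleftrightarrow>
     (\<forall>r < dim_row M. \<forall>c < j. c < r \<longrightarrow> p \<le> r \<longrightarrow> M $$ (r, c) = 0)"

text \<open>A maximum is at most \<open>p\<close> iff each of its members is, so the profile is
  determined by the zero patterns that hold for each \<open>p\<close>.\<close>

lemma staircase_le_iff: "staircase M j \<le> p \<longleftrightarrow> lower_zero p j M"
proof (induction j)
  case 0
  show ?case by (simp add: lower_zero_def)
next
  case (Suc j)
  let ?X = "{i. Suc j < i \<and> i \<le> dim_row M \<and> M $$ (i - 1, j) \<noteq> 0}"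
  have "finite ?X"
    by (rule finite_subset[of _ "{..dim_row M}"]) auto
  then have "Max (insert 0 ?X) \<le> p \<longleftrightarrow> (\<forall>i\<in>?X. i \<le> p)"
    by simp
  \<comment> \<open>Contraposition together with the shift \<open>i = Suc r\<close> between 1-based
    and 0-based rows.\<close>
  also have "\<dots> \<longleftrightarrow> (\<forall>r < dim_row M. j < r \<longrightarrow> p \<le> r \<longrightarrow> M $$ (r, j) = 0)"
  proof (intro iffI allI impI ballI)
    fix r
    assume "\<forall>i\<in>?X. i \<le> p" "r < dim_row M" "j < r" "p \<le> r"
    then show "M $$ (r, j) = 0"
      by (auto dest!: spec[of _ "Suc r"])
  next
    fix i
    assume *: "\<forall>r < dim_row M. j < r \<longrightarrow> p \<le> r \<longrightarrow> M $$ (r, j) = 0" and i: "i \<in> ?X"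
    show "i \<le> p"
    proof (rule ccontr)
      assume "\<not> i \<le> p"
      with i have "i - 1 < dim_row M" "j < i - 1" "p \<le> i - 1" by auto
      with i * show False by auto
    qed
  qed
  finally show ?case
    using Suc.IH by (auto simp: lower_zero_def less_Suc_eq)
qed

text \<open>Row \<open>r\<close> of \<open>T * M\<close> combines only rows of \<open>M\<close> from
  \<open>r\<close> downward, and the zero region is closed under moving down. The nonzero diagonal
  allows the factor to be cancelled.\<close>

lemma lower_zero_mult_left_iff:
  fixes T M :: "'a :: idom mat"
  assumes T: "T \<in> carrier_mat n n" and M: "M \<in> carrier_mat n q" and "j \<le> q"
    and "upper_triangular T" and diag: "\<And>i. i < n \<Longrightarrow> T $$ (i, i) \<noteq> 0"
  shows "lower_zero p j (T * M) \<longleftrightarrow> lower_zero p j M"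
proof -
  \<comment> \<open>Terms with \<open>l < r\<close> vanish by triangularity of \<open>T\<close>,
    those with \<open>l > r\<close> by the zeros of \<open>M\<close> below row
    \<open>r\<close>.\<close>
  have entry: "(T * M) $$ (r, c) = T $$ (r, r) * M $$ (r, c)"
    if "r < n" "c < j" and below: "\<And>l. r < l \<Longrightarrow> l < n \<Longrightarrow> M $$ (l, c) = 0" for r c
  proof -
    have "(T * M) $$ (r, c) = (\<Sum>l<n. T $$ (r, l) * M $$ (l, c))"
      using mat_mult_entry[OF T M] that \<open>j \<le> q\<close> by simp
    also have "\<dots> = (\<Sum>l\<in>{r}. T $$ (r, l) * M $$ (l, c))"
    proof (rule sum.mono_neutral_right)
      show "\<forall>l\<in>{..<n} - {r}. T $$ (r, l) * M $$ (l, c) = 0"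
      proof
        fix l assume "l \<in> {..<n} - {r}"
        then consider "l < r" | "r < l" "l < n" by fastforce
        then show "T $$ (r, l) * M $$ (l, c) = 0"
          using upper_triangularD[OF \<open>upper_triangular T\<close>, of l r] below that T by cases auto
      qed
    qed (use that in auto)
    finally show ?thesis by simp
  qed
  show ?thesis
  proof
    assume TM: "lower_zero p j (T * M)"
    \<comment> \<open>Induction from the bottom row upward: the rows below \<open>r\<close> are
      already known to vanish in column \<open>c\<close>.\<close>
    have "M $$ (r, c) = 0" if "r < n" "c < j" "c < r" "p \<le> r" for r c
      using that
    proof (induction "n - r" arbitrary: r rule: less_induct)
      case less
      have "(T * M) $$ (r, c) = T $$ (r, r) * M $$ (r, c)"
        by (rule entry) (use less in auto)
      then show ?case
        using TM diag less.prems T by (auto simp: lower_zero_def)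
    qed
    then show "lower_zero p j M"
      using M by (auto simp: lower_zero_def)
  next
    assume "lower_zero p j M"
    then show "lower_zero p j (T * M)"
      using entry T M by (auto simp: lower_zero_def simp del: index_mult_mat(1))
  qed
qed

text \<open>Mirror image for columns: column \<open>c\<close> of \<open>M * S\<close> combines only
  columns up to \<open>c\<close>, and the zero region is closed under moving left, so the induction
  runs from left to right.\<close>

lemma lower_zero_mult_right_iff:
  fixes S M :: "'a :: idom mat"
  assumes S: "S \<in> carrier_mat n n" and M: "M \<in> carrier_mat q n" and "j \<le> n"
    and "upper_triangular S" and diag: "\<And>i. i < n \<Longrightarrow> S $$ (i, i) \<noteq> 0"
  shows "lower_zero p j (M * S) \<longleftrightarrow> lower_zero p j M"
proof -
  have entry: "(M * S) $$ (r, c) = M $$ (r, c) * S $$ (c, c)"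
    if "r < q" "c < j" and left: "\<And>l. l < c \<Longrightarrow> M $$ (r, l) = 0" for r c
  proof -
    have "(M * S) $$ (r, c) = (\<Sum>l<n. M $$ (r, l) * S $$ (l, c))"
      using mat_mult_entry[OF M S] that \<open>j \<le> n\<close> by simp
    also have "\<dots> = (\<Sum>l\<in>{c}. M $$ (r, l) * S $$ (l, c))"
    proof (rule sum.mono_neutral_right)
      show "\<forall>l\<in>{..<n} - {c}. M $$ (r, l) * S $$ (l, c) = 0"
      proof
        fix l assume "l \<in> {..<n} - {c}"
        then consider "l < c" | "c < l" "l < n" by fastforce
        then show "M $$ (r, l) * S $$ (l, c) = 0"
          using upper_triangularD[OF \<open>upper_triangular S\<close>, of c l] left S by cases auto
      qed
    qed (use that \<open>j \<le> n\<close> in auto)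
    finally show ?thesis by simp
  qed
  show ?thesis
  proof
    assume MS: "lower_zero p j (M * S)"
    have "M $$ (r, c) = 0" if "r < q" "c < j" "c < r" "p \<le> r" for r c
      using that
    proof (induction c rule: less_induct)
      case (less c)
      have "(M * S) $$ (r, c) = M $$ (r, c) * S $$ (c, c)"
        by (rule entry) (use less in auto)
      then show ?case
        using MS diag less.prems M \<open>j \<le> n\<close> by (auto simp: lower_zero_def)
    qed
    then show "lower_zero p j M"
      using M by (auto simp: lower_zero_def)
  next
    assume "lower_zero p j M"
    then show "lower_zero p j (M * S)"
      using entry S M by (auto simp: lower_zero_def simp del: index_mult_mat(1))
  qed
qed

lemma det_upper_triangular_neq_0:
  fixes T :: "'a :: idom mat"
  assumes "T \<in> carrier_mat n n" "upper_triangular T" "\<And>i. i < n \<Longrightarrow> T $$ (i, i) \<noteq> 0"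
  shows "det T \<noteq> 0"
  using upper_triangular_imp_det_eq_0_iff[OF assms(1,2)] assms by (auto simp: diag_mat_def)

lemma det_unitary_neq_0:
  assumes "unitary_mat M"
  shows "det M \<noteq> 0"
proof
  assume "det M = 0"
  have M: "M \<in> carrier_mat (dim_row M) (dim_row M)"
    using assms by (auto simp: unitary_mat_def)
  have "det M * det (mat_adjoint M) = det (M * mat_adjoint M)"
    using det_mult[OF M mat_adjoint_carrier[OF M]] by simp
  also have "\<dots> = 1"
    using assms by (simp add: unitary_mat_def)
  finally show False
    using \<open>det M = 0\<close> by simp
qed

lemma invertible_mat_if_det_neq_0:
  fixes A :: "'a :: field mat"
  assumes A: "A \<in> carrier_mat n n" and "det A \<noteq> 0"
  shows "invertible_mat A"
proof -
  \<comment> \<open>The argument \<open>()\<close> fills the free extension slot of the record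
    \<open>ring_mat\<close>; being a unit there yields the two-sided inverse.\<close>
  from det_non_zero_imp_unit[OF assms, unfolded Units_def, of "()"]
  obtain B where "B \<in> carrier_mat n n" "B * A = 1\<^sub>m n" "A * B = 1\<^sub>m n"
    by (auto simp: ring_mat_def)
  with A show ?thesis
    by (auto simp: invertible_mat_def inverts_mat_def intro!: exI[of _ B])
qed

theorem theorem3p2:
  fixes n k m :: nat
    and L R U Uh E Z F Ah A B :: "complex mat"
  assumes "n \<ge> 1" and "k \<ge> 1" and "m = n + k"
    and "L \<in> carrier_mat m m" and "unitary_mat L" and "proper_lower_hessenberg k L"
    and "R \<in> carrier_mat m m" and "unitary_mat R" and "proper_upper_hessenberg k R"
    and "Uh \<in> carrier_mat n n" and "unitary_mat Uh"
    and "U = four_block_mat (1\<^sub>m k) (0\<^sub>m k n) (0\<^sub>m n k) Uh"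
    and "E = 1\<^sub>m k @\<^sub>r 0\<^sub>m n k"
    and "Z \<in> carrier_mat m k"
    and "F = U + E * mat_adjoint Z"
    and "Ah = L * F * R"
    and "A \<in> carrier_mat n n" and "B \<in> carrier_mat n k"
    and "Ah = four_block_mat A B (0\<^sub>m k n) (0\<^sub>m k k)"
  shows "invertible_mat A \<and> (\<forall>j \<in> {1..n}. staircase A j = staircase Uh j)"
proof -
  \<comment> \<open>Entry \<open>(i, j)\<close> of \<open>T\<close> is entry
    \<open>(i + k, j)\<close> of the adjoint of \<open>L\<close>.\<close>
  define T where "T = mat n n (\<lambda>(i, j). cnj (L $$ (j, i + k)))"
  define S where "S = mat n n (\<lambda>(i, j). R $$ (i + k, j))"
  have L: "L \<in> carrier_mat m m" and R: "R \<in> carrier_mat m m" and Uh: "Uh \<in> carrier_mat n n"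
    and Z: "Z \<in> carrier_mat m k" and A: "A \<in> carrier_mat n n" and B: "B \<in> carrier_mat n k"
    and m: "m = n + k"
    using assms by auto
  have Ladj: "mat_adjoint L \<in> carrier_mat m m" and Zadj: "mat_adjoint Z \<in> carrier_mat k m"
    using L Z by auto
  have U: "U \<in> carrier_mat m m"
    using Uh assms(12) m by (simp add: add.commute)
  have E: "E \<in> carrier_mat m k"
    unfolding assms(13) m by (subst add.commute) (rule carrier_append_rows; simp)
  have F: "F \<in> carrier_mat m m"
    unfolding assms(15) using U mult_carrier_mat[OF E Zadj] by simp
  have Ah: "Ah \<in> carrier_mat m m"
    unfolding assms(16) using L F R by auto

  \<comment> \<open>The last \<open>n\<close> rows of \<open>E\<close> are zero, so \<open>F\<close>
    agrees with \<open>U\<close> there.\<close>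
  have F_entry: "F $$ (k + i, l) = (if l < k then 0 else Uh $$ (i, l - k))"
    if "i < n" "l < m" for i l
  proof -
    have "E $$ (k + i, q) = 0" if "q < k" for q
      using \<open>i < n\<close> that unfolding assms(13) append_rows_def by simp
    then have "(E * mat_adjoint Z) $$ (k + i, l) = 0"
      using mat_mult_entry[OF E Zadj, of "k + i" l] that m by simp
    then have "F $$ (k + i, l) = U $$ (k + i, l)"
      using that m E Zadj unfolding assms(15) by (simp del: index_mult_mat(1))
    also have "\<dots> = (if l < k then 0 else Uh $$ (i, l - k))"
      using that m Uh unfolding assms(12) by auto
    finally show ?thesis .
  qed

  have "F * R = (mat_adjoint L * L) * (F * R)"
    using assms(5) L F R by (simp add: unitary_mat_def)
  also have "\<dots> = mat_adjoint L * Ah"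
    unfolding assms(16) using Ladj L F R
    by (simp add: assoc_mult_mat[of _ m m _ m _ m])
  finally have FR: "F * R = mat_adjoint L * Ah" .

  have "Uh * S = T * A"
  proof (rule eq_matI)
    fix i j
    assume "i < dim_row (T * A)" "j < dim_col (T * A)"
    then have i: "i < n" and j: "j < n"
      using A by (auto simp: T_def)
    have "(Uh * S) $$ (i, j) = (\<Sum>l<n. Uh $$ (i, l) * R $$ (k + l, j))"
      using mat_mult_entry[OF Uh, of S n i j] i j by (simp add: S_def add.commute)
    \<comment> \<open>The \<open>k\<close> added leading terms vanish because these rows of
      \<open>F\<close> start with \<open>k\<close> zeros.\<close>
    also have "\<dots> = (\<Sum>l<k + n. F $$ (k + i, l) * R $$ (l, j))"
      unfolding sum_lessThan_add using i m by (simp add: F_entry)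
    also have "\<dots> = (F * R) $$ (k + i, j)"
      using mat_mult_entry[OF F R, of "k + i" j] i j m by (simp add: add.commute)
    also have "\<dots> = (\<Sum>l<n + k. mat_adjoint L $$ (k + i, l) * Ah $$ (l, j))"
      unfolding FR using mat_mult_entry[OF Ladj Ah, of "k + i" j] i j m by simp
    \<comment> \<open>The terms from the last \<open>k\<close> rows of \<open>Ah\<close> are zero,
      and its first \<open>n\<close> columns carry \<open>A\<close>.\<close>
    also have "\<dots> = (\<Sum>l<n. cnj (L $$ (l, k + i)) * A $$ (l, j))"
      unfolding sum_lessThan_add assms(19) using i j m A B L
      by (simp add: mat_adjoint_entry)
    also have "\<dots> = (T * A) $$ (i, j)"
      using mat_mult_entry[of T n n A n i j] A i j by (simp add: T_def add.commute)
    finally show "(Uh * S) $$ (i, j) = (T * A) $$ (i, j)" .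
  qed (use Uh A in \<open>auto simp: S_def T_def\<close>)

  have S: "S \<in> carrier_mat n n" and T: "T \<in> carrier_mat n n"
    by (auto simp: S_def T_def)
  \<comment> \<open>The row shift by \<open>k\<close> moves the outermost Hessenberg diagonal,
    nonzero by properness, onto the main diagonal.\<close>
  have S_tri: "upper_triangular S" and S_diag: "\<And>i. i < n \<Longrightarrow> S $$ (i, i) \<noteq> 0"
    using assms(9) R m
    by (auto simp: S_def proper_upper_hessenberg_def upper_hessenberg_def)
  have T_tri: "upper_triangular T" and T_diag: "\<And>i. i < n \<Longrightarrow> T $$ (i, i) \<noteq> 0"
    using assms(6) L m
    by (auto simp: T_def proper_lower_hessenberg_def lower_hessenberg_def)

  have "det T * det A = det Uh * det S"
    using \<open>Uh * S = T * A\<close> det_mult[OF T A] det_mult[OF Uh S] by simp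
  then have "det A \<noteq> 0"
    using det_unitary_neq_0[OF assms(11)] det_upper_triangular_neq_0[OF S S_tri S_diag] by auto
  then have "invertible_mat A"
    by (rule invertible_mat_if_det_neq_0[OF A])
  moreover have "staircase A j = staircase Uh j" if "j \<in> {1..n}" for j
  proof -
    have "j \<le> n" using that by simp
    \<comment> \<open>Both patterns are compared with that of the common product
      \<open>T * A = Uh * S\<close>.\<close>
    have "lower_zero p j A \<longleftrightarrow> lower_zero p j Uh" for p
      using lower_zero_mult_left_iff[OF T A \<open>j \<le> n\<close> T_tri T_diag]
        lower_zero_mult_right_iff[OF S Uh \<open>j \<le> n\<close> S_tri S_diag] \<open>Uh * S = T * A\<close>
      by simp
    then have "staircase A j \<le> p \<longleftrightarrow> staircase Uh j \<le> p" for p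
      by (simp add: staircase_le_iff)
    then show ?thesis
      \<comment> \<open>Taking \<open>p\<close> to be each of the two values in turn gives both
        inequalities.\<close>
      by (meson order_antisym order_refl)
  qed
  ultimately show ?thesis by blast
qed

end
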